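(* For every pair $Q_1,Q_2$ of CRPQs, the following are equivalent: (1) $Q_1\subseteq_{a\text{-}inj}Q_2$, i.e. $Q_1(G)^{a\text{-}inj}\subseteq Q_2(G)^{a\text{-}inj}$ for every graph database $G$. (2) For every $F_1\in\mathrm{Exp}^{a\text{-}inj}(Q_1)$ there is $E_2\in\mathrm{Exp}(Q_2)$ such that $E_2\xrightarrow{a\text{-}inj}F_1$. (3) For every $F_1\in\mathrm{Exp}^{a\text{-}inj}(Q_1)$ there is $F_2\in\mathrm{Exp}^{a\text{-}inj}(Q_2)$ such that $F_2\xrightarrow{inj}F_1$.
   Context: A graph database over a finite alphabet $\mathbb{A}$ is a finite edge-labeled directed graph $G=(V,E)$ with $E\subseteq V\times\mathbb{A}\times V$. A path from $u$ to $v$ is a sequence of edges $v_0\xrightarrow{a_1}v_1,\dots,v_{k-1}\xrightarrow{a_k}v_k$ of $G$ with $k\ge 0$, $u=v_0$, $v=v_k$; its label is $a_1\cdots a_k$. It is a simple path if all $v_i$ are pairwise distinct, and a simple cycle if $v_0=v_k$ and $v_0,\dots,v_{k-1}$ are pairwise distinct. A conjunctive regular path query (CRPQ) over $\mathbb{A}$ is an expression $Q(\bar z)=A_1\wedge\dots\wedge A_m$ ($m\ge 0$), where each atom $A_i$ has the form $x_i\xrightarrow{L_i}y_i$ with $x_i,y_i$ variables (possibly equal) and $L_i$ a regular expression over $\mathbb{A}$, and $\bar z$ is a tuple of (not necessarily distinct) free variables; $\mathrm{vars}(Q)$ is its set of variables (including the free ones). A conjunctive query (CQ) is a CRPQ in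 which every $L_i$ is a single letter; a CQ is identified with the graph database whose vertices are its variables and whose edges are its atoms. Atom-injective semantics. If no $L_i$ contains the empty word $\epsilon$, then $Q(G)^{a\text{-}inj}$ is the set of tuples $\bar v$ for which there is a map $\mu:\mathrm{vars}(Q)\to V$ with $\mu(\bar z)=\bar v$ and, for each $i$, a path $\pi_i$ from $\mu(x_i)$ to $\mu(y_i)$ in $G$ with label in $L_i$, which is a simple path if $x_i\ne y_i$ and a simple cycle if $x_i=y_i$. If $Q(\bar z)=x\xrightarrow{L}y\wedge Q'$ with $\epsilon\in L$, then $Q(G)^{a\text{-}inj}$ is (recursively) the union of the evaluation of $x\xrightarrow{L\setminus\{\epsilon\}}y\wedge Q'$ with free tuple $\bar z$ and the evaluation of $Q'[x/y]$ with free tuple $\bar z[x/y]$, where $[x/y]$ replaces every occurrence of $x$ by $y$; the variable $y$ is kept as a variable of the resulting query even if it no longer occurs in any atom. Homomorphisms. A homomorphism from a CQ $P(\bar x)$ to $(G,\bar v)$ is a map $h:\mathrm{vars}(P)\to V$ with $h(\bar x)=\bar v$ such that $h(x)\xrightarrow{a}h(y)$ is an edge of $G$ for each atom $x\xrightarrow{a}y$ of $P$. For CQs $P(\bar x)$, $P'(\bar x')$, write $P\xrightarrow{inj}P'$ if there is an injective homomorphism from $P$ to $(P',\bar x')$, with $P'$ seen as a graph database. Expansions. For an atom $x\xrightarrow{L}y$ and $w=a_1\cdots a_k\in L$, the $w$-expansion is the conjunction $x\xrightarrow{a_1}z_1\wedge\dots\wedge z_{k-1}\xrightarrow{a_k}y$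 with fresh variables $z_i$ if $w\ne\epsilon$, and the equality atom $x=y$ if $w=\epsilon$. An expansion profile $\varphi$ of $Q(\bar x)=A_1\wedge\dots\wedge A_m$ maps each atom $A_i$ to a $w$-expansion of it for some $w$ in its language. The expansion $E$ produced by $\varphi$ is the CQ obtained from $\widetilde E(\bar x)=\varphi(A_1)\wedge\dots\wedge\varphi(A_m)$ by collapsing each class of the equivalence relation on variables generated by the equality atoms into a single variable (also in the free tuple); $\Phi:\mathrm{vars}(\widetilde E)\to\mathrm{vars}(E)$ is the canonical quotient map. $\mathrm{Exp}(Q)$ is the set of all expansions of $Q$. Variables $x,y\in\mathrm{vars}(E)$ are $\varphi$-atom-related if some $\varphi(A_i)$ contains variables $x',y'$ with $\Phi(x')=x$, $\Phi(y')=y$. Atom-injective homomorphisms. For $E\in\mathrm{Exp}(Q)$ and a CQ $P'(\bar x')$, write $E\xrightarrow{a\text{-}inj}P'$ if there are a homomorphism $h$ from $E$ to $(P',\bar x')$ and an expansion profile $\varphi$ producing $E$ such that $h(x)\neq h(y)$ for every pair of distinct $\varphi$-atom-related variables $x,y$. Atom-injective expansions. $\mathrm{Exp}^{a\text{-}inj}(Q)$ is the set of CQs $F$ obtained as follows: take an expansion $E(\bar z)$ of $Q$ produced by some profile $\varphi$ and a conjunction $J$ of equality atoms between variables of $E$ such that the equivalence relation generated by $J$ does not identify any two distinct $\varphi$-atom-related variables of $E$; $F$ is obtained from $E\wedge J$ by collapsing each equivalence class into a single variable (also in the free tuple). *)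

theory Defs
  imports Main "HOL-Library.Infinite_Typeclass"
begin

text \<open>Graph databases. The vertex set may be empty, as for the graph database of the query
  with no variables.\<close>

record ('v, 'a) graph_db =
  verts :: "'v set"
  edges :: "('v \<times> 'a \<times> 'v) set"

definition is_graph_db :: "'a set \<Rightarrow> ('v, 'a) graph_db \<Rightarrow> bool" where
  "is_graph_db A G \<longleftrightarrow> finite (verts G) \<and> edges G \<subseteq> verts G \<times> A \<times> verts G"

fun is_path :: "('v, 'a) graph_db \<Rightarrow> 'v \<Rightarrow> ('v \<times> 'a \<times> 'v) list \<Rightarrow> 'v \<Rightarrow> bool" where
  "is_path G u [] v \<longleftrightarrow> u = v \<and> u \<in> verts G"
| "is_path G u ((s, a, t) # p) v \<longleftrightarrow> s = u \<and> (s, a, t) \<in> edges G \<and> is_path G t p v"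

definition path_label :: "('v \<times> 'a \<times> 'v) list \<Rightarrow> 'a list" where
  "path_label p = map (\<lambda>(s, a, t). a) p"

definition is_simple_path :: "('v, 'a) graph_db \<Rightarrow> 'v \<Rightarrow> ('v \<times> 'a \<times> 'v) list \<Rightarrow> 'v \<Rightarrow> bool" where
  "is_simple_path G u p v \<longleftrightarrow> is_path G u p v \<and> distinct (u # map (\<lambda>(s, a, t). t) p)"

definition is_simple_cycle :: "('v, 'a) graph_db \<Rightarrow> 'v \<Rightarrow> ('v \<times> 'a \<times> 'v) list \<Rightarrow> 'v \<Rightarrow> bool" where
  "is_simple_cycle G u p v \<longleftrightarrow> is_path G u p v \<and> u = v \<and> distinct (map (\<lambda>(s, a, t). s) p)"

datatype 'a rexp =
    Zero
  | One
  | Atom 'a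
  | Plus "'a rexp" "'a rexp"
  | Times "'a rexp" "'a rexp"
  | Star "'a rexp"

fun lang :: "'a rexp \<Rightarrow> 'a list set" where
  "lang Zero = {}"
| "lang One = {[]}"
| "lang (Atom a) = {[a]}"
| "lang (Plus r s) = lang r \<union> lang s"
| "lang (Times r s) = {u @ w | u w. u \<in> lang r \<and> w \<in> lang s}"
| "lang (Star r) = {concat ws | ws. set ws \<subseteq> lang r}"

definition regular_over :: "'a set \<Rightarrow> 'a list set \<Rightarrow> bool" where
  "regular_over A L \<longleftrightarrow> (\<exists>r. set_rexp r \<subseteq> A \<and> lang r = L)"

text \<open>
  An atom carries the language of its regular expression, so that removing the empty word
  is literally a set difference. The variable set is explicit because collapsing a variable
  may leave variables that are neither free nor contained in any atom.
\<close>

record ('x, 'a) crpq =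
  qvars :: "'x set"
  atoms :: "('x \<times> 'a list set \<times> 'x) list"
  qfree :: "'x list"

definition is_crpq :: "'a set \<Rightarrow> ('x, 'a) crpq \<Rightarrow> bool" where
  "is_crpq A Q \<longleftrightarrow>
     finite (qvars Q) \<and> set (qfree Q) \<subseteq> qvars Q \<and>
     (\<forall>(x, L, y) \<in> set (atoms Q). x \<in> qvars Q \<and> y \<in> qvars Q \<and> regular_over A L)"

definition subst_var :: "'x \<Rightarrow> 'x \<Rightarrow> 'x \<Rightarrow> 'x" where
  "subst_var x y v = (if v = x then y else v)"

text \<open>For \<open>y\<close> among the variables of \<open>Q\<close>, \<open>y\<close> is also a variable of \<open>subst_crpq x y Q\<close>,
  whether or not it occurs in an atom.\<close>

definition subst_crpq :: "'x \<Rightarrow> 'x \<Rightarrow> ('x, 'a) crpq \<Rightarrow> ('x, 'a) crpq" where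
  "subst_crpq x y Q =
     \<lparr>qvars = subst_var x y ` qvars Q,
      atoms = map (\<lambda>(u, L, v). (subst_var x y u, L, subst_var x y v)) (atoms Q),
      qfree = map (subst_var x y) (qfree Q)\<rparr>"

text \<open>
  The last two rules are the two members of the union that defines the evaluation of a query
  with an atom whose language contains the empty word. They apply to any such atom, since the
  conjunction is unordered; the answers do not depend on the order of elimination.
\<close>

inductive ainj_answer :: "('v, 'a) graph_db \<Rightarrow> ('x, 'a) crpq \<Rightarrow> 'v list \<Rightarrow> bool"
  for G :: "('v, 'a) graph_db" where
  eps_free:
    "ainj_answer G Q (map \<mu> (qfree Q))"
    if "\<forall>(x, L, y) \<in> set (atoms Q). [] \<notin> L"
    and "\<mu> ` qvars Q \<subseteq> verts G"
    and "\<forall>(x, L, y) \<in> set (atoms Q). \<exists>p. path_label p \<in> L \<and>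
           (if x = y then is_simple_cycle G (\<mu> x) p (\<mu> y) else is_simple_path G (\<mu> x) p (\<mu> y))"
| eps_remove:
    "ainj_answer G Q vs"
    if "atoms Q = As @ (x, L, y) # Bs" and "[] \<in> L"
    and "ainj_answer G (Q\<lparr>atoms := As @ (x, L - {[]}, y) # Bs\<rparr>) vs"
| eps_collapse:
    "ainj_answer G Q vs"
    if "atoms Q = As @ (x, L, y) # Bs" and "[] \<in> L"
    and "ainj_answer G (subst_crpq x y (Q\<lparr>atoms := As @ Bs\<rparr>)) vs"

definition ainj_eval :: "('x, 'a) crpq \<Rightarrow> ('v, 'a) graph_db \<Rightarrow> 'v list set" where
  "ainj_eval Q G = {vs. ainj_answer G Q vs}"

text \<open>A conjunctive query is the graph database of its variables and atoms together with its
  free tuple.\<close>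

record ('v, 'a) cq =
  db :: "('v, 'a) graph_db"
  free :: "'v list"

definition is_hom :: "('u \<Rightarrow> 'v) \<Rightarrow> ('u, 'a) cq \<Rightarrow> ('v, 'a) graph_db \<Rightarrow> 'v list \<Rightarrow> bool" where
  "is_hom h P G vs \<longleftrightarrow>
     h ` verts (db P) \<subseteq> verts G \<and> map h (free P) = vs \<and>
     (\<forall>(x, a, y) \<in> edges (db P). (h x, a, h y) \<in> edges G)"

definition inj_hom :: "('u, 'a) cq \<Rightarrow> ('v, 'a) cq \<Rightarrow> bool" where
  "inj_hom P P' \<longleftrightarrow> (\<exists>h. is_hom h P (db P') (free P') \<and> inj_on h (verts (db P)))"

text \<open>Collapsing equality atoms: the new variables are the equivalence classes.\<close>

definition eq_class :: "('v \<times> 'v) set \<Rightarrow> 'v \<Rightarrow> 'v set" where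
  "eq_class J v = {u. equivclp (\<lambda>x y. (x, y) \<in> J) v u}"

definition collapse :: "('v \<times> 'v) set \<Rightarrow> ('v, 'a) cq \<Rightarrow> ('v set, 'a) cq" where
  "collapse J P =
     \<lparr>db = \<lparr>verts = eq_class J ` verts (db P),
            edges = (\<lambda>(x, a, y). (eq_class J x, a, eq_class J y)) ` edges (db P)\<rparr>,
      free = map (eq_class J) (free P)\<rparr>"

text \<open>
  \<open>Fresh i j\<close> is the \<open>j\<close>-th fresh variable in the expansion of the \<open>i\<close>-th atom.
  A profile is given by the list of the words chosen for the atoms.
\<close>

datatype 'x evar = Var 'x | Fresh nat nat

definition is_profile :: "('x, 'a) crpq \<Rightarrow> 'a list list \<Rightarrow> bool" where
  "is_profile Q \<phi> \<longleftrightarrow> list_all2 (\<lambda>(x, L, y) w. w \<in> L) (atoms Q) \<phi>"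

text \<open>The \<open>j\<close>-th variable on the path that expands the atom with index \<open>i\<close>, endpoints \<open>x\<close> and
  \<open>y\<close> and a nonempty word of length \<open>k\<close>.\<close>

definition exp_node :: "nat \<Rightarrow> 'x \<Rightarrow> 'x \<Rightarrow> nat \<Rightarrow> nat \<Rightarrow> 'x evar" where
  "exp_node i x y k j = (if j = 0 then Var x else if j = k then Var y else Fresh i j)"

definition word_exp_vars :: "nat \<Rightarrow> 'x \<Rightarrow> 'x \<Rightarrow> 'a list \<Rightarrow> 'x evar set" where
  "word_exp_vars i x y w = {Var x, Var y} \<union> {Fresh i j | j. 0 < j \<and> j < length w}"

definition word_exp_edges :: "nat \<Rightarrow> 'x \<Rightarrow> 'x \<Rightarrow> 'a list \<Rightarrow> ('x evar \<times> 'a \<times> 'x evar) set" where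
  "word_exp_edges i x y w =
     {(exp_node i x y (length w) j, w ! j, exp_node i x y (length w) (Suc j)) | j. j < length w}"

definition word_exp_eqs :: "'x \<Rightarrow> 'x \<Rightarrow> 'a list \<Rightarrow> ('x evar \<times> 'x evar) set" where
  "word_exp_eqs x y w = (if w = [] then {(Var x, Var y)} else {})"

definition atom_exp_vars :: "('x, 'a) crpq \<Rightarrow> 'a list list \<Rightarrow> nat \<Rightarrow> 'x evar set" where
  "atom_exp_vars Q \<phi> i = (case atoms Q ! i of (x, L, y) \<Rightarrow> word_exp_vars i x y (\<phi> ! i))"

definition pre_expansion :: "('x, 'a) crpq \<Rightarrow> 'a list list \<Rightarrow> ('x evar, 'a) cq" where
  "pre_expansion Q \<phi> =
     \<lparr>db = \<lparr>verts = Var ` qvars Q \<union> (\<Union>i<length (atoms Q). atom_exp_vars Q \<phi> i),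
            edges = (\<Union>i<length (atoms Q).
                       case atoms Q ! i of (x, L, y) \<Rightarrow> word_exp_edges i x y (\<phi> ! i))\<rparr>,
      free = map Var (qfree Q)\<rparr>"

definition expansion_eqs :: "('x, 'a) crpq \<Rightarrow> 'a list list \<Rightarrow> ('x evar \<times> 'x evar) set" where
  "expansion_eqs Q \<phi> =
     (\<Union>i<length (atoms Q). case atoms Q ! i of (x, L, y) \<Rightarrow> word_exp_eqs x y (\<phi> ! i))"

definition expansion :: "('x, 'a) crpq \<Rightarrow> 'a list list \<Rightarrow> ('x evar set, 'a) cq" where
  "expansion Q \<phi> = collapse (expansion_eqs Q \<phi>) (pre_expansion Q \<phi>)"

definition quotient_map :: "('x, 'a) crpq \<Rightarrow> 'a list list \<Rightarrow> 'x evar \<Rightarrow> 'x evar set" where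
  "quotient_map Q \<phi> = eq_class (expansion_eqs Q \<phi>)"

definition produces :: "('x, 'a) crpq \<Rightarrow> 'a list list \<Rightarrow> ('x evar set, 'a) cq \<Rightarrow> bool" where
  "produces Q \<phi> E \<longleftrightarrow> is_profile Q \<phi> \<and> E = expansion Q \<phi>"

definition Exp :: "('x, 'a) crpq \<Rightarrow> ('x evar set, 'a) cq set" where
  "Exp Q = {E. \<exists>\<phi>. produces Q \<phi> E}"

definition atom_related ::
  "('x, 'a) crpq \<Rightarrow> 'a list list \<Rightarrow> 'x evar set \<Rightarrow> 'x evar set \<Rightarrow> bool" where
  "atom_related Q \<phi> x y \<longleftrightarrow>
     (\<exists>i<length (atoms Q). \<exists>x' \<in> atom_exp_vars Q \<phi> i. \<exists>y' \<in> atom_exp_vars Q \<phi> i.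
        quotient_map Q \<phi> x' = x \<and> quotient_map Q \<phi> y' = y)"

definition ainj_hom :: "('x, 'a) crpq \<Rightarrow> ('x evar set, 'a) cq \<Rightarrow> ('v, 'a) cq \<Rightarrow> bool" where
  "ainj_hom Q E P' \<longleftrightarrow>
     (\<exists>h \<phi>. is_hom h E (db P') (free P') \<and> produces Q \<phi> E \<and>
        (\<forall>x y. atom_related Q \<phi> x y \<and> x \<noteq> y \<longrightarrow> h x \<noteq> h y))"

definition Exp_ainj :: "('x, 'a) crpq \<Rightarrow> ('x evar set set, 'a) cq set" where
  "Exp_ainj Q =
     {collapse J E | E J. \<exists>\<phi>. produces Q \<phi> E \<and> J \<subseteq> verts (db E) \<times> verts (db E) \<and>
        (\<forall>x y. atom_related Q \<phi> x y \<and> x \<noteq> y \<longrightarrow> \<not> equivclp (\<lambda>u v. (u, v) \<in> J) x y)}"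

end

theory Submission
  imports Defs
begin

text \<open>
  Every condition is reduced to \<open>ainj_sat\<close>: some expansion of the query maps homomorphically to
  \<open>(G, vs)\<close> such that distinct atom-related variables have distinct images. Identifying the
  variables of the expansion with equal images turns such a homomorphism into an injective one
  from an atom-injective expansion, and every injective homomorphism arises in this way. This
  gives (2) \<open>\<longleftrightarrow>\<close> (3), and, as \<open>ainj_sat\<close> characterises the atom-injective answers and is
  preserved by injective homomorphisms, also (1) \<open>\<longleftrightarrow>\<close> (2): the atom-injective expansions of the
  first query, copied into an infinite type, are the canonical databases to be tested.
\<close>

section \<open>Generated equivalences and collapsing\<close>

text \<open>For the converse the invariant is membership in the class of \<open>u\<close>. In this
  form, comparing two generated equivalences along a map only requires moving an invariant
  \<open>P\<close> along that map.\<close>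

lemma equivclp_iff_invariant:
  "equivclp R u v \<longleftrightarrow> (\<forall>P. (\<forall>x y. R x y \<longrightarrow> P x = P y) \<longrightarrow> P u = (P v :: bool))"
proof
  assume "equivclp R u v"
  then show "\<forall>P. (\<forall>x y. R x y \<longrightarrow> P x = P y) \<longrightarrow> P u = (P v :: bool)"
    by (induction rule: equivclp_induct) blast+
next
  assume *: "\<forall>P. (\<forall>x y. R x y \<longrightarrow> P x = P y) \<longrightarrow> P u = (P v :: bool)"
  have "equivclp R u x = equivclp R u y" if "R x y" for x y
    using that by (meson equivclp_sym equivclp_trans r_into_equivclp)
  with * have "equivclp R u u = equivclp R u v"
    by blast
  then show "equivclp R u v"
    by simp
qed

lemma equivclp_respects:
  assumes "equivclp R u v" and "\<And>x y. R x y \<Longrightarrow> f x = f y"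
  shows "f u = f v"
  using assms by (induction rule: equivclp_induct) metis+

lemma eq_class_eq_iff: "eq_class J u = eq_class J v \<longleftrightarrow> equivclp (\<lambda>x y. (x, y) \<in> J) u v"
  unfolding eq_class_def by (auto intro: equivclp_trans equivclp_sym)

text \<open>Each class is nonempty and \<open>f\<close> is constant on it, so the value at any
  chosen representative serves.\<close>

lemma factor_through_eq_class:
  assumes "\<And>x y. (x, y) \<in> J \<Longrightarrow> f x = f y"
  obtains h where "h \<circ> eq_class J = f"
proof
  show "(\<lambda>S. f (SOME u. u \<in> S)) \<circ> eq_class J = f"
  proof
    fix u
    have "u \<in> eq_class J u"
      by (simp add: eq_class_def)
    then have "(SOME v. v \<in> eq_class J u) \<in> eq_class J u"
      by (rule someI)
    then show "((\<lambda>S. f (SOME u. u \<in> S)) \<circ> eq_class J) u = f u"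
      using equivclp_respects[of _ u _ f] assms unfolding eq_class_def by fastforce
  qed
qed

text \<open>Vertices, edges and free tuple of the quotient are images under
  \<open>eq_class J\<close>, so no representatives are involved. Homomorphisms from an expansion can
  thus be studied on \<open>pre_expansion\<close>.\<close>

lemma is_hom_collapse: "is_hom h (collapse J P) G vs \<longleftrightarrow> is_hom (h \<circ> eq_class J) P G vs"
  unfolding is_hom_def collapse_def by (auto simp: image_image split: prod.splits)

lemma is_hom_comp:
  assumes "is_hom h P (db P') (free P')" and "is_hom g P' G vs"
  shows "is_hom (g \<circ> h) P G vs"
  unfolding is_hom_def
proof (intro conjI)
  show "(g \<circ> h) ` verts (db P) \<subseteq> verts G"
    using assms unfolding is_hom_def by (auto simp: image_subset_iff)
  show "map (g \<circ> h) (free P) = vs"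
    using assms unfolding is_hom_def by (metis map_map)
  show "\<forall>(x, a, y) \<in> edges (db P). ((g \<circ> h) x, a, (g \<circ> h) y) \<in> edges G"
    using assms unfolding is_hom_def by auto
qed

section \<open>Atom-injective homomorphisms from expansions\<close>

definition ainj_sat :: "('x, 'a) crpq \<Rightarrow> ('v, 'a) graph_db \<Rightarrow> 'v list \<Rightarrow> bool" where
  "ainj_sat Q G vs \<longleftrightarrow>
     (\<exists>\<phi> h. is_profile Q \<phi> \<and> is_hom h (expansion Q \<phi>) G vs \<and>
        (\<forall>x y. atom_related Q \<phi> x y \<and> x \<noteq> y \<longrightarrow> h x \<noteq> h y))"

lemma ainj_hom_iff_ainj_sat:
  "(\<exists>E \<in> Exp Q. ainj_hom Q E P) \<longleftrightarrow> ainj_sat Q (db P) (free P)"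
proof
  assume "\<exists>E \<in> Exp Q. ainj_hom Q E P"
  then obtain E h \<phi> where "is_hom h E (db P) (free P)" "produces Q \<phi> E"
    "\<forall>x y. atom_related Q \<phi> x y \<and> x \<noteq> y \<longrightarrow> h x \<noteq> h y"
    unfolding ainj_hom_def by blast
  then show "ainj_sat Q (db P) (free P)"
    unfolding ainj_sat_def produces_def by (intro exI[of _ \<phi>] exI[of _ h]) simp
next
  assume "ainj_sat Q (db P) (free P)"
  then obtain \<phi> h where *: "is_profile Q \<phi>" "is_hom h (expansion Q \<phi>) (db P) (free P)"
    "\<forall>x y. atom_related Q \<phi> x y \<and> x \<noteq> y \<longrightarrow> h x \<noteq> h y"
    unfolding ainj_sat_def by blast
  then have "produces Q \<phi> (expansion Q \<phi>)"
    by (simp add: produces_def)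
  then show "\<exists>E \<in> Exp Q. ainj_hom Q E P"
    unfolding ainj_hom_def using *(2,3) by (auto simp: Exp_def)
qed

lemma atom_exp_vars_quotient_in_verts:
  assumes "i < length (atoms Q)" and "x \<in> atom_exp_vars Q \<phi> i"
  shows "quotient_map Q \<phi> x \<in> verts (db (expansion Q \<phi>))"
  using assms
  unfolding expansion_def collapse_def pre_expansion_def quotient_map_def by auto

lemma atom_related_in_verts:
  assumes "atom_related Q \<phi> x y"
  shows "x \<in> verts (db (expansion Q \<phi>))" and "y \<in> verts (db (expansion Q \<phi>))"
  using assms atom_exp_vars_quotient_in_verts unfolding atom_related_def by blast+

lemma ainj_sat_iff_inj_hom:
  "ainj_sat Q G vs \<longleftrightarrow> (\<exists>F \<in> Exp_ainj Q. \<exists>g. is_hom g F G vs \<and> inj_on g (verts (db F)))"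
proof
  assume "ainj_sat Q G vs"
  then obtain \<phi> h where \<phi>: "is_profile Q \<phi>" and h: "is_hom h (expansion Q \<phi>) G vs"
    and inj: "\<And>x y. atom_related Q \<phi> x y \<Longrightarrow> x \<noteq> y \<Longrightarrow> h x \<noteq> h y"
    unfolding ainj_sat_def by blast
  define V where "V = verts (db (expansion Q \<phi>))"
  \<comment> \<open>The kernel of \<open>h\<close>, cut down to the vertices because
    \<open>Exp_ainj\<close> admits only equalities between variables of the expansion.\<close>
  define J where "J = {(x, y). x \<in> V \<and> y \<in> V \<and> h x = h y}"
  have resp: "h x = h y" if "(x, y) \<in> J" for x y
    using that by (simp add: J_def)
  then obtain g where g: "g \<circ> eq_class J = h"
    by (rule factor_through_eq_class)
  have "\<not> equivclp (\<lambda>u v. (u, v) \<in> J) x y" if "atom_related Q \<phi> x y" "x \<noteq> y" for x y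
    using inj[OF that] equivclp_respects[of _ x y h] resp by blast
  moreover have "J \<subseteq> V \<times> V"
    by (auto simp: J_def)
  ultimately have "collapse J (expansion Q \<phi>) \<in> Exp_ainj Q"
    unfolding Exp_ainj_def produces_def V_def using \<phi> by blast
  moreover have "is_hom g (collapse J (expansion Q \<phi>)) G vs"
    using h by (simp add: is_hom_collapse g)
  moreover have "inj_on g (verts (db (collapse J (expansion Q \<phi>))))"
  proof (rule inj_onI)
    fix S T
    assume "S \<in> verts (db (collapse J (expansion Q \<phi>)))"
      and "T \<in> verts (db (collapse J (expansion Q \<phi>)))" and "g S = g T"
    then obtain s t where "S = eq_class J s" "T = eq_class J t" "s \<in> V" "t \<in> V" "h s = h t"
      unfolding g[symmetric] by (auto simp: collapse_def V_def)
    then show "S = T"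
      by (auto simp: eq_class_eq_iff J_def intro!: r_into_equivclp)
  qed
  ultimately show "\<exists>F \<in> Exp_ainj Q. \<exists>g. is_hom g F G vs \<and> inj_on g (verts (db F))"
    by blast
next
  assume "\<exists>F \<in> Exp_ainj Q. \<exists>g. is_hom g F G vs \<and> inj_on g (verts (db F))"
  then obtain \<phi> J g where \<phi>: "is_profile Q \<phi>"
    and J: "\<And>x y. atom_related Q \<phi> x y \<Longrightarrow> x \<noteq> y \<Longrightarrow> \<not> equivclp (\<lambda>u v. (u, v) \<in> J) x y"
    and g: "is_hom g (collapse J (expansion Q \<phi>)) G vs"
      "inj_on g (verts (db (collapse J (expansion Q \<phi>))))"
    unfolding Exp_ainj_def produces_def by blast
  \<comment> \<open>Atom-related variables are vertices, so their classes lie in the set on which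
    \<open>g\<close> is injective.\<close>
  have "(g \<circ> eq_class J) x \<noteq> (g \<circ> eq_class J) y" if "atom_related Q \<phi> x y" "x \<noteq> y" for x y
    using J[OF that] atom_related_in_verts[OF that(1)] g(2)
    by (auto simp: collapse_def inj_on_def eq_class_eq_iff)
  then show "ainj_sat Q G vs"
    using \<phi> g(1) unfolding ainj_sat_def is_hom_collapse by blast
qed

text \<open>In the form given by \<open>ainj_sat_iff_inj_hom\<close> this is the composition of
  injective homomorphisms.\<close>

lemma ainj_sat_inj_hom:
  assumes "ainj_sat Q (db P) (free P)" and "is_hom g P G vs" and "inj_on g (verts (db P))"
  shows "ainj_sat Q G vs"
proof -
  obtain F h where F: "F \<in> Exp_ainj Q" and h: "is_hom h F (db P) (free P)" "inj_on h (verts (db F))"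
    using assms(1) unfolding ainj_sat_iff_inj_hom by blast
  have "h ` verts (db F) \<subseteq> verts (db P)"
    using h(1) by (simp add: is_hom_def)
  then have "inj_on (g \<circ> h) (verts (db F))"
    using h(2) assms(3) by (meson comp_inj_on inj_on_subset)
  then show ?thesis
    unfolding ainj_sat_iff_inj_hom using F is_hom_comp[OF h(1) assms(2)] by blast
qed

lemma Exp_ainj_sat:
  assumes "F \<in> Exp_ainj Q"
  shows "ainj_sat Q (db F) (free F)"
proof -
  have "is_hom id F (db F) (free F)"
    by (auto simp: is_hom_def)
  then show ?thesis
    unfolding ainj_sat_iff_inj_hom using assms inj_on_id by blast
qed

section \<open>Paths as indexed vertex sequences\<close>

text \<open>\<open>f j\<close> is the vertex reached after \<open>j\<close> edges. The last two
  equations express the sources and all visited vertices by \<open>f\<close>, so that distinctness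
  becomes injectivity of \<open>f\<close> below \<open>length p\<close> for cycles, and up to and
  including \<open>length p\<close> for paths.\<close>

lemma is_path_nodes:
  assumes "is_path G u p v"
  defines "f \<equiv> \<lambda>j. (u # map (\<lambda>(s, a, t). t) p) ! j"
  shows "f (length p) = v" and "v \<in> verts G"
    and "\<forall>j < length p. (f j, path_label p ! j, f (Suc j)) \<in> edges G"
    and "map (\<lambda>(s, a, t). s) p = map f [0..<length p]"
    and "u # map (\<lambda>(s, a, t). t) p = map f [0..<Suc (length p)]"
proof -
  have "(u # map (\<lambda>(s, a, t). t) p) ! length p = v \<and> v \<in> verts G \<and>
      (\<forall>j < length p. ((u # map (\<lambda>(s, a, t). t) p) ! j, path_label p ! j,
         (u # map (\<lambda>(s, a, t). t) p) ! Suc j) \<in> edges G) \<and>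
      map (\<lambda>(s, a, t). s) p = map (\<lambda>j. (u # map (\<lambda>(s, a, t). t) p) ! j) [0..<length p]"
    using assms(1)
  proof (induction p arbitrary: u)
    case (Cons e p)
    obtain s a t where e: "e = (s, a, t)"
      by (metis prod_cases3)
    have "is_path G t p v"
      using Cons.prems by (simp add: e)
    note IH = Cons.IH[OF this]
    have "[0..<length (e # p)] = 0 # map Suc [0..<length p]"
      by (simp add: map_Suc_upt upt_conv_Cons del: upt_Suc)
    with IH Cons.prems show ?case
      by (auto simp: e path_label_def nth_Cons split: nat.splits)
  qed auto
  then show "f (length p) = v" and "v \<in> verts G"
    and "\<forall>j < length p. (f j, path_label p ! j, f (Suc j)) \<in> edges G"
    and "map (\<lambda>(s, a, t). s) p = map f [0..<length p]"
    by (simp_all add: f_def)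
  show "u # map (\<lambda>(s, a, t). t) p = map f [0..<Suc (length p)]"
    unfolding f_def by (rule nth_equalityI) (simp_all del: upt_Suc)
qed

lemma is_path_of_nodes:
  assumes "\<forall>j < length w. (f j, w ! j, f (Suc j)) \<in> edges G" and "f (length w) \<in> verts G"
  defines "p \<equiv> map (\<lambda>j. (f j, w ! j, f (Suc j))) [0..<length w]"
  shows "is_path G (f 0) p (f (length w))"
proof -
  \<comment> \<open>Suffixes are treated by induction on the start index \<open>i\<close>, going
    down from \<open>length w\<close>.\<close>
  have "is_path G (f i) (map (\<lambda>j. (f j, w ! j, f (Suc j))) [i..<length w]) (f (length w))"
    if "i \<le> length w" for i
    using that
  proof (induction i rule: inc_induct)
    case base
    then show ?case
      using assms(2) by simp
  next
    case (step i)
    then show ?case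
      using assms(1) by (simp add: upt_conv_Cons)
  qed
  then show ?thesis
    unfolding p_def by simp
qed

text \<open>One notion for simple paths and simple cycles: the only coincidence allowed is between
  the first and the last position, and for a nonempty word it occurs exactly when
  \<open>u = v\<close>. The indexing matches the positions of \<open>exp_node\<close>.\<close>

definition simple_walk :: "('v, 'a) graph_db \<Rightarrow> 'v \<Rightarrow> 'a list \<Rightarrow> 'v \<Rightarrow> (nat \<Rightarrow> 'v) \<Rightarrow> bool" where
  "simple_walk G u w v f \<longleftrightarrow>
     f 0 = u \<and> f (length w) = v \<and> v \<in> verts G \<and>
     (\<forall>j < length w. (f j, w ! j, f (Suc j)) \<in> edges G) \<and>
     (\<forall>a b. a < b \<and> b \<le> length w \<and> f a = f b \<longrightarrow> a = 0 \<and> b = length w)"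

lemma simple_path_or_cycle_iff_simple_walk:
  assumes "w \<noteq> []"
  shows "(\<exists>p. path_label p = w \<and>
            (if u = v then is_simple_cycle G u p v else is_simple_path G u p v)) \<longleftrightarrow>
         (\<exists>f. simple_walk G u w v f)"
proof
  assume "\<exists>p. path_label p = w \<and>
    (if u = v then is_simple_cycle G u p v else is_simple_path G u p v)"
  then obtain p where p: "path_label p = w"
    "if u = v then is_simple_cycle G u p v else is_simple_path G u p v"
    by blast
  then have path: "is_path G u p v"
    by (auto simp: is_simple_cycle_def is_simple_path_def split: if_splits)
  define f where "f j = (u # map (\<lambda>(s, a, t). t) p) ! j" for j
  note f = is_path_nodes[OF path, folded f_def]
  have len: "length w = length p"
    using p(1) by (auto simp: path_label_def)
  have f0: "f 0 = u"
    by (simp add: f_def)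
  have "a = 0 \<and> b = length w" if "a < b" "b \<le> length w" "f a = f b" for a b
  proof (cases "u = v")
    case True
    then have "distinct (map f [0..<length p])"
      using p(2) f(4) by (simp add: is_simple_cycle_def)
    then have inj: "inj_on f {0..<length p}"
      by (simp add: distinct_map)
    show ?thesis
    proof (cases "b = length p")
      case True
      \<comment> \<open>The cycle ends at its start and its sources are pairwise distinct, so only
        position 0 can share the last vertex.\<close>
      then have "f a = f 0"
        using that f(1) f0 \<open>u = v\<close> by simp
      then have "a = 0"
        using inj_onD[OF inj, of a 0] that True by (cases p) simp_all
      then show ?thesis
        using True len by simp
    next
      case False
      then have "b < length p"
        using that len by simp
      then show ?thesis
        using inj_onD[OF inj, of a b] that by simp
    qed
  next
    case False
    then have "distinct (map f [0..<Suc (length p)])"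
      using p(2) f(5) by (simp add: is_simple_path_def del: upt_Suc distinct.simps)
    then have inj: "inj_on f {0..<Suc (length p)}"
      by (simp add: distinct_map del: upt_Suc)
    show ?thesis
      using inj_onD[OF inj, of a b] that len by simp
  qed
  then have "simple_walk G u w v f"
    unfolding simple_walk_def using f(1-3) f0 len p(1) by auto
  then show "\<exists>f. simple_walk G u w v f"
    by blast
next
  assume "\<exists>f. simple_walk G u w v f"
  then obtain f where walk: "simple_walk G u w v f"
    by blast
  then have f: "f 0 = u" "f (length w) = v" "v \<in> verts G"
    "\<forall>j < length w. (f j, w ! j, f (Suc j)) \<in> edges G"
    by (simp_all add: simple_walk_def)
  have inj: "a = 0 \<and> b = length w" if "a < b" "b \<le> length w" "f a = f b" for a b
    using walk that unfolding simple_walk_def by blast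
  define p where "p = map (\<lambda>j. (f j, w ! j, f (Suc j))) [0..<length w]"
  have path: "is_path G u p v"
    using is_path_of_nodes[of w f G] f(1-4) by (simp add: p_def)
  have label: "path_label p = w"
    by (simp add: p_def path_label_def comp_def map_nth)
  have src: "map (\<lambda>(s, a, t). s) p = map f [0..<length w]"
    by (simp add: p_def)
  have "map (\<lambda>(s, a, t). t) p = map f (map Suc [0..<length w])"
    by (simp add: p_def)
  then have tgt: "u # map (\<lambda>(s, a, t). t) p = map f [0..<Suc (length w)]"
    by (simp add: map_Suc_upt upt_conv_Cons f(1) del: upt_Suc)
  have "if u = v then is_simple_cycle G u p v else is_simple_path G u p v"
  proof (cases "u = v")
    case True
    have "inj_on f {0..<length w}"
    proof (rule linorder_inj_onI)
      fix a b
      assume "a < b" and "b \<in> {0..<length w}"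
      then show "f a \<noteq> f b"
        using inj[of a b] by auto
    qed auto
    then show ?thesis
      using True path by (simp add: is_simple_cycle_def src distinct_map)
  next
    case False
    have "inj_on f {0..<Suc (length w)}"
    proof (rule linorder_inj_onI)
      fix a b
      assume "a < b" and "b \<in> {0..<Suc (length w)}"
      then show "f a \<noteq> f b"
        using f(1,2) inj[of a b] False by auto
    qed auto
    then show ?thesis
      using False path
      by (simp add: is_simple_path_def tgt distinct_map del: upt_Suc distinct.simps)
  qed
  then show "\<exists>p. path_label p = w \<and>
      (if u = v then is_simple_cycle G u p v else is_simple_path G u p v)"
    using label by (intro exI[of _ p] conjI)
qed

section \<open>Atom-injective answers as expansions\<close>

text \<open>\<open>zs\<close> pairs each atom with the word chosen for it. The empty words give the
  equality atoms, here between query variables, before \<open>Var\<close> is applied.\<close>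

definition var_eqs :: "(('x \<times> 'a list set \<times> 'x) \<times> 'a list) list \<Rightarrow> ('x \<times> 'x) set" where
  "var_eqs zs = {(x, y). \<exists>L. ((x, L, y), []) \<in> set zs}"

fun realizes_atom ::
  "('v, 'a) graph_db \<Rightarrow> ('x \<Rightarrow> 'x \<Rightarrow> bool) \<Rightarrow> ('x \<Rightarrow> 'v) \<Rightarrow>
     ('x \<times> 'a list set \<times> 'x) \<times> 'a list \<Rightarrow> bool" where
  "realizes_atom G R \<mu> ((x, L, y), w) \<longleftrightarrow>
     w \<in> L \<and>
     (if w = [] then \<mu> x = \<mu> y
      else (\<exists>f. simple_walk G (\<mu> x) w (\<mu> y) f) \<and> (\<mu> x = \<mu> y \<longrightarrow> R x y))"

text \<open>Here \<open>\<mu> x = \<mu> y\<close> asks for a cycle where the query has \<open>x \<noteq> y\<close>, so it is only allowed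
  if the elimination of empty words has identified \<open>x\<close> and \<open>y\<close>.\<close>

definition realizes ::
  "('v, 'a) graph_db \<Rightarrow> (('x \<times> 'a list set \<times> 'x) \<times> 'a list) list \<Rightarrow> ('x \<Rightarrow> 'v) \<Rightarrow> bool" where
  "realizes G zs \<mu> \<longleftrightarrow>
     (\<forall>z \<in> set zs. realizes_atom G (equivclp (\<lambda>x y. (x, y) \<in> var_eqs zs)) \<mu> z)"

section \<open>Effect of one elimination step on chosen words and assignments\<close>

fun subst_atom ::
  "'x \<Rightarrow> 'x \<Rightarrow> ('x \<times> 'a list set \<times> 'x) \<times> 'a list \<Rightarrow> ('x \<times> 'a list set \<times> 'x) \<times> 'a list" where
  "subst_atom x y ((u, L, v), w) = ((subst_var x y u, L, subst_var x y v), w)"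

text \<open>An invariant of the right side takes equal values at \<open>a\<close> and
  \<open>subst_var x y a\<close>; an invariant \<open>P\<close> of the left side yields the
  invariant \<open>P \<circ> subst_var x y\<close> of the right side.\<close>

lemma equivclp_subst_var:
  "equivclp (\<lambda>a b. (a, b) \<in> map_prod (subst_var x y) (subst_var x y) ` J)
      (subst_var x y u) (subst_var x y v) \<longleftrightarrow>
   equivclp (\<lambda>a b. (a, b) \<in> insert (x, y) J) u v" (is "?L \<longleftrightarrow> ?R")
proof
  assume ?L
  show ?R
    unfolding equivclp_iff_invariant
  proof (intro allI impI)
    fix P :: "_ \<Rightarrow> bool"
    assume P: "\<forall>a b. (a, b) \<in> insert (x, y) J \<longrightarrow> P a = P b"
    then have "P (subst_var x y a) = P a" for a
      by (auto simp: subst_var_def)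
    then have "P (subst_var x y u) = P (subst_var x y v)"
      using P by (intro equivclp_respects[OF \<open>?L\<close>]) auto
    then show "P u = P v"
      using \<open>\<And>a. P (subst_var x y a) = P a\<close> by simp
  qed
next
  assume ?R
  show ?L
    unfolding equivclp_iff_invariant
  proof (intro allI impI)
    fix P :: "_ \<Rightarrow> bool"
    assume P: "\<forall>a b. (a, b) \<in> map_prod (subst_var x y) (subst_var x y) ` J \<longrightarrow> P a = P b"
    show "P (subst_var x y u) = P (subst_var x y v)"
    proof (rule equivclp_respects[OF \<open>?R\<close>])
      fix a b
      assume "(a, b) \<in> insert (x, y) J"
      then show "P (subst_var x y a) = P (subst_var x y b)"
      proof
        assume "(a, b) = (x, y)"
        then show ?thesis
          by (simp add: subst_var_def)
      next
        assume "(a, b) \<in> J"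
        then show ?thesis
          using P by (metis map_prod_imageI)
      qed
    qed
  qed
qed

lemma var_eqs_subst_atom:
  "var_eqs (map (subst_atom x y) zs) =
     map_prod (subst_var x y) (subst_var x y) ` var_eqs zs"
proof (intro equalityI subrelI)
  fix a b
  assume "(a, b) \<in> var_eqs (map (subst_atom x y) zs)"
  then obtain u L v where "((u, L, v), []) \<in> set zs" "a = subst_var x y u" "b = subst_var x y v"
    by (auto simp: var_eqs_def)
  then show "(a, b) \<in> map_prod (subst_var x y) (subst_var x y) ` var_eqs zs"
    by (intro image_eqI[of _ _ "(u, v)"]) (auto simp: var_eqs_def)
next
  fix a b
  assume "(a, b) \<in> map_prod (subst_var x y) (subst_var x y) ` var_eqs zs"
  then obtain u L v where "((u, L, v), []) \<in> set zs" "a = subst_var x y u" "b = subst_var x y v"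
    by (auto simp: var_eqs_def)
  then show "(a, b) \<in> var_eqs (map (subst_atom x y) zs)"
    using imageI[of "((u, L, v), [])" "set zs" "subst_atom x y"] by (auto simp: var_eqs_def)
qed

text \<open>The counterpart of \<open>eps_collapse\<close>. Once \<open>\<mu> x = \<mu> y\<close>,
  substitution does not change the values under \<open>\<mu>\<close>, and by
  \<open>equivclp_subst_var\<close> the equivalence generated after it pulls back to the one before
  it. The remaining atoms therefore correspond one by one.\<close>

lemma realizes_collapse_iff:
  "realizes G (zs @ ((x, L, y), []) # zs') \<mu> \<longleftrightarrow>
     [] \<in> L \<and> \<mu> x = \<mu> y \<and> realizes G (map (subst_atom x y) (zs @ zs')) \<mu>"
proof (cases "\<mu> x = \<mu> y")
  case True
  define R where "R = equivclp (\<lambda>x' y'. (x', y') \<in> var_eqs (zs @ ((x, L, y), []) # zs'))"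
  define R' where
    "R' = equivclp (\<lambda>x' y'. (x', y') \<in> var_eqs (map (subst_atom x y) (zs @ zs')))"
  have "var_eqs (zs @ ((x, L, y), []) # zs') = insert (x, y) (var_eqs (zs @ zs'))"
    by (auto simp: var_eqs_def)
  then have R: "R' (subst_var x y u) (subst_var x y v) \<longleftrightarrow> R u v" for u v
    unfolding R_def R'_def by (simp only: var_eqs_subst_atom equivclp_subst_var)
  have \<mu>: "\<mu> (subst_var x y u) = \<mu> u" for u
    using True by (simp add: subst_var_def)
  have atom: "realizes_atom G R' \<mu> (subst_atom x y z) = realizes_atom G R \<mu> z" for z
  proof -
    obtain u L v w where "z = ((u, L, v), w)"
      by (metis prod_cases3 surj_pair)
    then show ?thesis
      by (simp add: R \<mu>)
  qed
  then show ?thesis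
    using True unfolding realizes_def R_def[symmetric] R'_def[symmetric]
    by (simp add: atom ball_Un conj_ac)
qed (simp add: realizes_def)

text \<open>If \<open>x \<noteq> y\<close>, then \<open>x\<close> no longer occurs in the
  substituted atoms, so its value may be reset to that of \<open>y\<close>. This supplies the
  equation asked for by \<open>realizes_collapse_iff\<close>.\<close>

lemma realizes_subst_var:
  "realizes G (map (subst_atom x y) zs) (\<mu> \<circ> subst_var x y) \<longleftrightarrow>
     realizes G (map (subst_atom x y) zs) \<mu>"
proof -
  have idem: "subst_var x y (subst_var x y u) = subst_var x y u" for u
    by (simp add: subst_var_def)
  have "realizes_atom G R (\<mu> \<circ> subst_var x y) (subst_atom x y z) =
      realizes_atom G R \<mu> (subst_atom x y z)" for R z
  proof -
    obtain u L v w where "z = ((u, L, v), w)"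
      by (metis prod_cases3 surj_pair)
    then show ?thesis
      by (simp add: idem)
  qed
  then show ?thesis
    unfolding realizes_def by simp
qed

text \<open>The counterpart of \<open>eps_remove\<close>: \<open>var_eqs\<close> reads only atoms
  with an empty word.\<close>

lemma realizes_remove_iff:
  assumes "w \<noteq> []"
  shows "realizes G (zs @ ((x, L - {[]}, y), w) # zs') \<mu> \<longleftrightarrow>
    realizes G (zs @ ((x, L, y), w) # zs') \<mu>"
proof -
  have "var_eqs (zs @ ((x, L - {[]}, y), w) # zs') = var_eqs (zs @ ((x, L, y), w) # zs')"
    using assms by (auto simp: var_eqs_def)
  then show ?thesis
    using assms by (simp add: realizes_def)
qed

lemma map_fst_subst_atom:
  "map fst (map (subst_atom x y) zs) =
     map (\<lambda>(u, L, v). (subst_var x y u, L, subst_var x y v)) (map fst zs)"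
  by (induction zs) auto

text \<open>Substitution keeps the words, so words chosen for the substituted query are choices for
  the original atoms.\<close>

lemma subst_atom_lift:
  assumes "map fst zs = map (\<lambda>(u, L, v). (subst_var x y u, L, subst_var x y v)) as"
  shows "\<exists>zs'. map fst zs' = as \<and> map (subst_atom x y) zs' = zs"
  using assms
proof (induction as arbitrary: zs)
  case (Cons a as)
  then obtain w zs1 where zs: "zs = (case a of (u, L, v) \<Rightarrow> (subst_var x y u, L, subst_var x y v), w) # zs1"
    and "map fst zs1 = map (\<lambda>(u, L, v). (subst_var x y u, L, subst_var x y v)) as"
    by (auto simp: map_eq_Cons_conv)
  with Cons.IH obtain zs' where "map fst zs' = as" "map (subst_atom x y) zs' = zs1"
    by blast
  then show ?case
    by (intro exI[of _ "(a, w) # zs'"]) (cases a, simp add: zs)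
qed simp

text \<open>The recursion on empty words is replaced by one choice of all words at once. This is the
  link between \<open>ainj_answer\<close> and \<open>ainj_sat\<close>.\<close>

definition realized :: "('v, 'a) graph_db \<Rightarrow> ('x, 'a) crpq \<Rightarrow> 'v list \<Rightarrow> bool" where
  "realized G Q vs \<longleftrightarrow>
     (\<exists>zs \<mu>. map fst zs = atoms Q \<and> realizes G zs \<mu> \<and> \<mu> ` qvars Q \<subseteq> verts G \<and>
        vs = map \<mu> (qfree Q))"

lemma ainj_answer_realized:
  assumes "ainj_answer G Q vs"
  shows "realized G Q vs"
  using assms
proof (induction rule: ainj_answer.induct)
  case (eps_free Q \<mu>)
  \<comment> \<open>The words are chosen atom by atom, before \<open>zs\<close> and the equivalence
    it generates are known. Reflexivity of \<open>R\<close> suffices, as distinct endpoints of an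
    atom get distinct values here.\<close>
  have "\<exists>w. \<forall>R. (\<forall>u. R u u) \<longrightarrow> realizes_atom G R \<mu> (a, w)"
    if mem: "a \<in> set (atoms Q)" for a
  proof -
    obtain x L y where a: "a = (x, L, y)"
      by (metis prod_cases3)
    obtain p where p: "path_label p \<in> L"
      "if x = y then is_simple_cycle G (\<mu> x) p (\<mu> y) else is_simple_path G (\<mu> x) p (\<mu> y)"
      using bspec[OF eps_free(3) mem] by (auto simp: a)
    have ne: "path_label p \<noteq> []"
      using p(1) eps_free(1) mem a by auto
    then have "p \<noteq> []"
      by (auto simp: path_label_def)
    have xy: "\<mu> x = \<mu> y \<longleftrightarrow> x = y"
    proof (cases "x = y")
      case False
      then have path: "is_path G (\<mu> x) p (\<mu> y)"
        and dist: "distinct (\<mu> x # map (\<lambda>(s, a, t). t) p)"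
        using p(2) by (simp_all add: is_simple_path_def)
      \<comment> \<open>A nonempty simple path ends in its last target, which differs from its
        start; hence \<open>\<mu> x \<noteq> \<mu> y\<close>.\<close>
      have "map (\<lambda>(s, a, t). t) p ! (length p - 1) = \<mu> y"
        using is_path_nodes(1)[OF path] \<open>p \<noteq> []\<close> by (simp add: nth_Cons split: nat.splits)
      then have "\<mu> y \<in> set (map (\<lambda>(s, a, t). t) p)"
        using \<open>p \<noteq> []\<close> by (metis diff_less length_greater_0_conv length_map less_one nth_mem)
      then show ?thesis
        using dist False by (metis distinct.simps(2))
    qed simp
    then have "\<exists>f. simple_walk G (\<mu> x) (path_label p) (\<mu> y) f"
      using p(2) by (subst simple_path_or_cycle_iff_simple_walk[OF ne, symmetric])
        (intro exI[of _ p], simp)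
    then have "\<forall>R. (\<forall>u. R u u) \<longrightarrow> realizes_atom G R \<mu> (a, path_label p)"
      using p(1) ne xy by (auto simp: a)
    then show ?thesis
      by blast
  qed
  then obtain w where
    w: "\<And>a R. a \<in> set (atoms Q) \<Longrightarrow> (\<And>u. R u u) \<Longrightarrow> realizes_atom G R \<mu> (a, w a)"
    by metis
  define zs where "zs = map (\<lambda>a. (a, w a)) (atoms Q)"
  have "realizes G zs \<mu>"
    unfolding realizes_def using w by (auto simp: zs_def)
  moreover have "map fst zs = atoms Q"
    by (simp add: zs_def comp_def)
  ultimately show ?case
    unfolding realized_def using eps_free(2) by blast
next
  case (eps_remove Q As x L y Bs vs)
  then obtain zs w zs' \<mu> where "map fst zs = As" "map fst zs' = Bs"
    and *: "realizes G (zs @ ((x, L - {[]}, y), w) # zs') \<mu>"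
    "\<mu> ` qvars Q \<subseteq> verts G" "vs = map \<mu> (qfree Q)"
    unfolding realized_def by (auto simp: map_eq_append_conv map_eq_Cons_conv)
  moreover have "w \<noteq> []"
    using * by (simp add: realizes_def)
  ultimately show ?case
    unfolding realized_def using eps_remove(1)
    by (intro exI[of _ "zs @ ((x, L, y), w) # zs'"] exI[of _ \<mu>]) (simp add: realizes_remove_iff)
next
  case (eps_collapse Q As x L y Bs vs)
  then obtain zs \<mu> where
    zs: "map fst zs = map (\<lambda>(u, L, v). (subst_var x y u, L, subst_var x y v)) (As @ Bs)"
    and \<mu>: "realizes G zs \<mu>" "\<mu> ` subst_var x y ` qvars Q \<subseteq> verts G"
      "vs = map (\<mu> \<circ> subst_var x y) (qfree Q)"
    unfolding realized_def by (auto simp: subst_crpq_def)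
  from subst_atom_lift[OF zs] obtain as bs where
    fst: "map fst as = As" "map fst bs = Bs" and lift: "map (subst_atom x y) (as @ bs) = zs"
    by (auto simp: map_eq_append_conv)
  \<comment> \<open>\<open>\<nu>\<close> gives \<open>x\<close> the value of \<open>y\<close>, as
    the empty word requires; by \<open>realizes_subst_var\<close> the substituted atoms stay
    realized.\<close>
  define \<nu> where "\<nu> = \<mu> \<circ> subst_var x y"
  have "realizes G zs \<nu>"
    using \<mu>(1) realizes_subst_var[of G x y "as @ bs" \<mu>] unfolding lift \<nu>_def by blast
  moreover have "\<nu> x = \<nu> y"
    by (simp add: \<nu>_def subst_var_def)
  ultimately have "realizes G (as @ ((x, L, y), []) # bs) \<nu>"
    using eps_collapse(2) by (simp only: realizes_collapse_iff lift)
  moreover have "map fst (as @ ((x, L, y), []) # bs) = atoms Q"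
    using eps_collapse(1) fst by simp
  moreover have "\<nu> ` qvars Q \<subseteq> verts G"
    using \<mu>(2) by (simp add: \<nu>_def image_comp)
  moreover have "vs = map \<nu> (qfree Q)"
    using \<mu>(3) by (simp add: \<nu>_def)
  ultimately show ?case
    unfolding realized_def by blast
qed

text \<open>Induction on the number of atoms whose language contains the empty word. The word chosen
  for such an atom selects the rule: an empty one \<open>eps_collapse\<close>, a nonempty one
  \<open>eps_remove\<close>. Both lower the count.\<close>

lemma realized_ainj_answer:
  assumes "realized G Q vs"
  shows "ainj_answer G Q vs"
  using assms
proof (induction "length (filter (\<lambda>a. [] \<in> fst (snd a)) (atoms Q))" arbitrary: Q rule: less_induct)
  case less
  obtain zs \<mu> where zs: "map fst zs = atoms Q" "realizes G zs \<mu>"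
    and \<mu>: "\<mu> ` qvars Q \<subseteq> verts G" "vs = map \<mu> (qfree Q)"
    using less.prems unfolding realized_def by blast
  show ?case
  proof (cases "\<exists>(x, L, y) \<in> set (atoms Q). [] \<in> L")
    case False
    then have no_eps: "\<forall>(x, L, y) \<in> set (atoms Q). [] \<notin> L"
      by blast
    have ne: "w \<noteq> []" if "((x, L, y), w) \<in> set zs" for x L y w
    proof -
      have "(x, L, y) \<in> set (atoms Q)"
        using that zs(1) by (metis fst_conv image_eqI set_map)
      then show ?thesis
        using no_eps that zs(2) unfolding realizes_def by fastforce
    qed
    then have "var_eqs zs = {}"
      by (fastforce simp: var_eqs_def)
    \<comment> \<open>Without empty words the generated equivalence is equality, so the distinction
      on \<open>x = y\<close> in the semantics agrees with the one on
      \<open>\<mu> x = \<mu> y\<close> in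
      \<open>simple_path_or_cycle_iff_simple_walk\<close>.\<close>
    then have eqv: "equivclp (\<lambda>u v. (u, v) \<in> var_eqs zs) u v \<longleftrightarrow> u = v" for u v
      using equivclp_respects[of "\<lambda>_ _. False" u v id] by (auto simp: id_def)
    have "\<exists>p. path_label p \<in> L \<and>
        (if x = y then is_simple_cycle G (\<mu> x) p (\<mu> y) else is_simple_path G (\<mu> x) p (\<mu> y))"
      if "(x, L, y) \<in> set (atoms Q)" for x L y
    proof -
      have "(x, L, y) \<in> set (map fst zs)"
        using that zs(1) by simp
      then obtain w where w: "((x, L, y), w) \<in> set zs"
        by auto
      then have "realizes_atom G (=) \<mu> ((x, L, y), w)"
        using zs(2) unfolding realizes_def eqv by blast
      then have "w \<in> L" "\<exists>f. simple_walk G (\<mu> x) w (\<mu> y) f" "\<mu> x = \<mu> y \<longleftrightarrow> x = y"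
        using ne[OF w] by auto
      then show ?thesis
        using simple_path_or_cycle_iff_simple_walk[OF ne[OF w], where G = G and u = "\<mu> x" and v = "\<mu> y"]
          by auto
    qed
    then have "\<forall>(x, L, y) \<in> set (atoms Q). \<exists>p. path_label p \<in> L \<and>
        (if x = y then is_simple_cycle G (\<mu> x) p (\<mu> y) else is_simple_path G (\<mu> x) p (\<mu> y))"
      by blast
    then show ?thesis
      unfolding \<mu>(2) by (rule ainj_answer.eps_free[where G = G, OF no_eps \<mu>(1)])
  next
    case True
    then obtain x L y where "(x, L, y) \<in> set (atoms Q)" and "[] \<in> L"
      by blast
    then obtain As Bs where Q: "atoms Q = As @ (x, L, y) # Bs"
      by (meson split_list)
    then obtain as w bs where split: "zs = as @ ((x, L, y), w) # bs"
      "map fst as = As" "map fst bs = Bs"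
      using zs(1) by (auto simp: map_eq_append_conv map_eq_Cons_conv)
    show ?thesis
    proof (cases "w = []")
      case True
      then have r: "\<mu> x = \<mu> y" "realizes G (map (subst_atom x y) (as @ bs)) \<mu>"
        using zs(2) unfolding split(1) True realizes_collapse_iff by blast+
      have \<mu>s: "\<mu> (subst_var x y u) = \<mu> u" for u
        using r(1) by (simp add: subst_var_def)
      define Q' where "Q' = subst_crpq x y (Q\<lparr>atoms := As @ Bs\<rparr>)"
      have "map fst (map (subst_atom x y) (as @ bs)) = atoms Q'"
        unfolding map_fst_subst_atom by (simp add: Q'_def subst_crpq_def split)
      moreover have "\<mu> ` qvars Q' \<subseteq> verts G" "vs = map \<mu> (qfree Q')"
        using \<mu> by (auto simp: Q'_def subst_crpq_def \<mu>s)
      ultimately have "realized G Q' vs"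
        unfolding realized_def using r(2) by blast
      moreover have "length (filter (\<lambda>a. [] \<in> fst (snd a)) (atoms Q')) <
          length (filter (\<lambda>a. [] \<in> fst (snd a)) (atoms Q))"
        using \<open>[] \<in> L\<close> by (simp add: Q'_def subst_crpq_def Q filter_map comp_def split_beta)
      ultimately have "ainj_answer G Q' vs"
        using less.hyps by blast
      then show ?thesis
        unfolding Q'_def by (rule ainj_answer.eps_collapse[OF Q \<open>[] \<in> L\<close>])
    next
      case False
      define Q' where "Q' = Q\<lparr>atoms := As @ (x, L - {[]}, y) # Bs\<rparr>"
      have "realizes G (as @ ((x, L - {[]}, y), w) # bs) \<mu>"
        using zs(2) False by (simp add: split(1) realizes_remove_iff)
      moreover have "map fst (as @ ((x, L - {[]}, y), w) # bs) = atoms Q'"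
        by (simp add: Q'_def split)
      moreover have "\<mu> ` qvars Q' \<subseteq> verts G" "vs = map \<mu> (qfree Q')"
        using \<mu> by (simp_all add: Q'_def)
      ultimately have "realized G Q' vs"
        unfolding realized_def by blast
      moreover have "length (filter (\<lambda>a. [] \<in> fst (snd a)) (atoms Q')) <
          length (filter (\<lambda>a. [] \<in> fst (snd a)) (atoms Q))"
        using \<open>[] \<in> L\<close> by (simp add: Q'_def Q)
      ultimately have "ainj_answer G Q' vs"
        using less.hyps by blast
      then show ?thesis
        unfolding Q'_def by (rule ainj_answer.eps_remove[OF Q \<open>[] \<in> L\<close>])
    qed
  qed
qed

section \<open>Equality atoms and the quotient map of an expansion\<close>

lemma equivclp_map_prod:
  assumes "inj f"
  shows "equivclp (\<lambda>a b. (a, b) \<in> map_prod f f ` J) (f u) (f v) \<longleftrightarrow>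
    equivclp (\<lambda>a b. (a, b) \<in> J) u v" (is "?L \<longleftrightarrow> ?R")
proof
  assume ?L
  show ?R
    unfolding equivclp_iff_invariant
  proof (intro allI impI)
    fix P :: "_ \<Rightarrow> bool"
    assume P: "\<forall>a b. (a, b) \<in> J \<longrightarrow> P a = P b"
    \<comment> \<open>Composition with the inverse of the injection \<open>f\<close> turns an
      invariant of \<open>J\<close> into one of its image.\<close>
    have "(P \<circ> inv f) (f u) = (P \<circ> inv f) (f v)"
      using P assms by (intro equivclp_respects[OF \<open>?L\<close>]) auto
    then show "P u = P v"
      using assms by simp
  qed
next
  assume ?R
  show ?L
    unfolding equivclp_iff_invariant
  proof (intro allI impI)
    fix P :: "_ \<Rightarrow> bool"
    assume P: "\<forall>a b. (a, b) \<in> map_prod f f ` J \<longrightarrow> P a = P b"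
    show "P (f u) = P (f v)"
      using P by (intro equivclp_respects[OF \<open>?R\<close>]) (metis map_prod_imageI)
  qed
qed

lemma expansion_eqs_iff:
  "(a, b) \<in> expansion_eqs Q \<phi> \<longleftrightarrow>
     (\<exists>i x L y. i < length (atoms Q) \<and> atoms Q ! i = (x, L, y) \<and> \<phi> ! i = [] \<and>
        a = Var x \<and> b = Var y)"
proof
  assume "(a, b) \<in> expansion_eqs Q \<phi>"
  then obtain i where i: "i < length (atoms Q)"
    "(a, b) \<in> (case atoms Q ! i of (x, L, y) \<Rightarrow> word_exp_eqs x y (\<phi> ! i))"
    by (auto simp: expansion_eqs_def)
  then show "\<exists>i x L y. i < length (atoms Q) \<and> atoms Q ! i = (x, L, y) \<and> \<phi> ! i = [] \<and>
      a = Var x \<and> b = Var y"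
    by (intro exI[of _ i]) (cases "atoms Q ! i", auto simp: word_exp_eqs_def split: if_splits)
next
  assume "\<exists>i x L y. i < length (atoms Q) \<and> atoms Q ! i = (x, L, y) \<and> \<phi> ! i = [] \<and>
      a = Var x \<and> b = Var y"
  then obtain i x L y where "i < length (atoms Q)" "atoms Q ! i = (x, L, y)" "\<phi> ! i = []"
    "a = Var x" "b = Var y"
    by blast
  then show "(a, b) \<in> expansion_eqs Q \<phi>"
    unfolding expansion_eqs_def by (intro UN_I[of i]) (simp_all add: word_exp_eqs_def)
qed

lemma expansion_eqs_eq:
  assumes "length \<phi> = length (atoms Q)"
  shows "expansion_eqs Q \<phi> = map_prod Var Var ` var_eqs (zip (atoms Q) \<phi>)"
proof -
  have "(x, y) \<in> var_eqs (zip (atoms Q) \<phi>) \<longleftrightarrow>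
      (\<exists>i L. i < length (atoms Q) \<and> atoms Q ! i = (x, L, y) \<and> \<phi> ! i = [])" for x y
    using assms unfolding var_eqs_def set_zip by (simp add: eq_commute conj_ac) metis
  then show ?thesis
    by (auto simp: expansion_eqs_iff intro!: map_prod_imageI) blast
qed

lemma quotient_map_eq_Var_iff:
  assumes "length \<phi> = length (atoms Q)"
  shows "quotient_map Q \<phi> (Var x) = quotient_map Q \<phi> (Var y) \<longleftrightarrow>
    equivclp (\<lambda>a b. (a, b) \<in> var_eqs (zip (atoms Q) \<phi>)) x y"
  unfolding quotient_map_def eq_class_eq_iff expansion_eqs_eq[OF assms]
  by (rule equivclp_map_prod) (simp add: inj_def)

text \<open>Equality atoms join only variables of the form \<open>Var x\<close>, so being
  \<open>Fresh i j\<close> is an invariant.\<close>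

lemma quotient_map_Fresh_eq_iff:
  "quotient_map Q \<phi> (Fresh i j) = quotient_map Q \<phi> v \<longleftrightarrow> v = Fresh i j"
proof
  assume "quotient_map Q \<phi> (Fresh i j) = quotient_map Q \<phi> v"
  then have "equivclp (\<lambda>a b. (a, b) \<in> expansion_eqs Q \<phi>) (Fresh i j) v"
    unfolding quotient_map_def eq_class_eq_iff .
  then show "v = Fresh i j"
    using equivclp_respects[of _ "Fresh i j" v "\<lambda>z. z = Fresh i j"]
    by (auto simp: expansion_eqs_iff)
qed simp

lemma exp_node_0: "exp_node i x y k 0 = Var x"
  and exp_node_length: "0 < k \<Longrightarrow> exp_node i x y k k = Var y"
  by (simp_all add: exp_node_def)

text \<open>Unless the positions are the two ends, one of them is interior; its fresh variable is
  alone in its class and does not occur at the other position.\<close>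

lemma quotient_map_exp_node_eq:
  assumes "quotient_map Q \<phi> (exp_node i x y k a) = quotient_map Q \<phi> (exp_node i x y k b)"
    and "a < b" and "b \<le> k"
  shows "a = 0 \<and> b = k"
proof (rule ccontr)
  assume "\<not> (a = 0 \<and> b = k)"
  then consider "exp_node i x y k a = Fresh i a" "exp_node i x y k b \<noteq> Fresh i a"
    | "exp_node i x y k b = Fresh i b" "exp_node i x y k a \<noteq> Fresh i b"
    using assms(2,3) by (auto simp: exp_node_def)
  then show False
    using assms(1) by cases (metis quotient_map_Fresh_eq_iff)+
qed

lemma word_exp_vars_eq:
  assumes "w \<noteq> []"
  shows "word_exp_vars i x y w = exp_node i x y (length w) ` {..length w}"
proof (intro equalityI subsetI)
  fix v
  assume "v \<in> word_exp_vars i x y w"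
  then consider "v = Var x" | "v = Var y" | j where "v = Fresh i j" "0 < j" "j < length w"
    by (auto simp: word_exp_vars_def)
  then show "v \<in> exp_node i x y (length w) ` {..length w}"
  proof cases
    case 1
    then show ?thesis
      by (intro image_eqI[of _ _ 0]) (simp_all add: exp_node_0)
  next
    case 2
    then show ?thesis
      using assms by (intro image_eqI[of _ _ "length w"]) (simp_all add: exp_node_length)
  next
    case 3
    then show ?thesis
      by (intro image_eqI[of _ _ j]) (simp_all add: exp_node_def)
  qed
qed (auto simp: word_exp_vars_def exp_node_def)

lemma is_profile_length: "is_profile Q \<phi> \<Longrightarrow> length \<phi> = length (atoms Q)"
  unfolding is_profile_def by (simp add: list_all2_lengthD)

section \<open>Realized word choices and homomorphisms from expansions\<close>

lemma ainj_sat_realized: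
  assumes "ainj_sat Q G vs"
  shows "realized G Q vs"
proof -
  obtain \<phi> h where \<phi>: "is_profile Q \<phi>" and h: "is_hom h (expansion Q \<phi>) G vs"
    and inj: "\<And>x y. atom_related Q \<phi> x y \<Longrightarrow> x \<noteq> y \<Longrightarrow> h x \<noteq> h y"
    using assms unfolding ainj_sat_def by blast
  define g where "g = h \<circ> quotient_map Q \<phi>"
  have g: "is_hom g (pre_expansion Q \<phi>) G vs"
    using h unfolding g_def quotient_map_def expansion_def is_hom_collapse .
  define \<mu> where "\<mu> = g \<circ> Var"
  note len = is_profile_length[OF \<phi>]
  have inj': "quotient_map Q \<phi> u = quotient_map Q \<phi> v"
    if "i < length (atoms Q)" "u \<in> atom_exp_vars Q \<phi> i" "v \<in> atom_exp_vars Q \<phi> i" "g u = g v"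
    for i u v
    using inj[of "quotient_map Q \<phi> u" "quotient_map Q \<phi> v"] that
    unfolding atom_related_def g_def comp_def by blast
  have "realizes_atom G (equivclp (\<lambda>x y. (x, y) \<in> var_eqs (zip (atoms Q) \<phi>))) \<mu>
      (atoms Q ! i, \<phi> ! i)" if i: "i < length (atoms Q)" for i
  proof -
    obtain x L y where a: "atoms Q ! i = (x, L, y)"
      by (metis prod_cases3)
    define w where "w = \<phi> ! i"
    have "w \<in> L"
      using \<phi> i a unfolding is_profile_def w_def by (auto dest!: list_all2_nthD)
    have vars: "atom_exp_vars Q \<phi> i = word_exp_vars i x y w"
      by (simp add: atom_exp_vars_def a w_def)
    have Var: "Var x \<in> atom_exp_vars Q \<phi> i" "Var y \<in> atom_exp_vars Q \<phi> i"
      unfolding vars by (simp_all add: word_exp_vars_def)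
    show ?thesis
    proof (cases "w = []")
      case True
      then have "(Var x, Var y) \<in> expansion_eqs Q \<phi>"
        unfolding expansion_eqs_iff w_def using i a by blast
      then have "quotient_map Q \<phi> (Var x) = quotient_map Q \<phi> (Var y)"
        unfolding quotient_map_def eq_class_eq_iff by (rule r_into_equivclp)
      then have "\<mu> x = \<mu> y"
        by (simp add: \<mu>_def g_def)
      then show ?thesis
        using \<open>w \<in> L\<close> True by (simp add: a w_def)
    next
      case False
      \<comment> \<open>The walk reads off \<open>g\<close> along the path that expands the atom. A
        coincidence on it forces equal classes, which \<open>quotient_map_exp_node_eq\<close> allows
        only at the two ends.\<close>
      define f where "f j = g (exp_node i x y (length w) j)" for j
      have "(exp_node i x y (length w) j, w ! j, exp_node i x y (length w) (Suc j))
          \<in> edges (db (pre_expansion Q \<phi>))" if "j < length w" for j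
        using i a that unfolding pre_expansion_def w_def
        by (auto simp: word_exp_edges_def intro!: bexI[of _ i])
      then have "\<forall>j < length w. (f j, w ! j, f (Suc j)) \<in> edges G"
        using g unfolding is_hom_def f_def by blast
      moreover have "f 0 = \<mu> x" and fy: "f (length w) = \<mu> y"
        using False by (simp_all add: f_def \<mu>_def exp_node_0 exp_node_length)
      moreover have "Var y \<in> verts (db (pre_expansion Q \<phi>))"
        using i Var(2) by (auto simp: pre_expansion_def)
      then have "\<mu> y \<in> verts G"
        using g unfolding is_hom_def \<mu>_def by auto
      moreover have "a = 0 \<and> b = length w" if "a < b" "b \<le> length w" "f a = f b" for a b
      proof (rule quotient_map_exp_node_eq)
        show "quotient_map Q \<phi> (exp_node i x y (length w) a) =
            quotient_map Q \<phi> (exp_node i x y (length w) b)"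
          using that by (intro inj'[OF i]) (auto simp: vars word_exp_vars_eq[OF False] f_def)
      qed (use that in auto)
      ultimately have "simple_walk G (\<mu> x) w (\<mu> y) f"
        unfolding simple_walk_def by auto
      \<comment> \<open>The endpoints are atom-related, so equal images mean equal classes: the
        empty words have already identified \<open>x\<close> and \<open>y\<close>.\<close>
      moreover have "equivclp (\<lambda>x y. (x, y) \<in> var_eqs (zip (atoms Q) \<phi>)) x y" if "\<mu> x = \<mu> y"
        using inj'[OF i Var] that by (simp add: \<mu>_def quotient_map_eq_Var_iff[OF len])
      ultimately show ?thesis
        using \<open>w \<in> L\<close> False unfolding a w_def[symmetric] by auto
    qed
  qed
  then have "realizes G (zip (atoms Q) \<phi>) \<mu>"
    unfolding realizes_def by (auto simp: set_zip simp del: realizes_atom.simps)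
  moreover have "map fst (zip (atoms Q) \<phi>) = atoms Q"
    using len by simp
  moreover have "\<mu> ` qvars Q \<subseteq> verts G" "vs = map \<mu> (qfree Q)"
    using g by (auto simp: is_hom_def \<mu>_def pre_expansion_def)
  ultimately show ?thesis
    unfolding realized_def by blast
qed

lemma simple_walk_in_verts:
  assumes "simple_walk G u w v f" and "is_graph_db A G" and "j \<le> length w"
  shows "f j \<in> verts G"
proof (cases "j = length w")
  case False
  then have "(f j, w ! j, f (Suc j)) \<in> edges G"
    using assms(1,3) by (simp add: simple_walk_def)
  then show ?thesis
    using assms(2) by (auto simp: is_graph_db_def)
qed (use assms(1) in \<open>simp add: simple_walk_def\<close>)

text \<open>The homomorphism is glued from \<open>\<mu>\<close> on the query variables and the walks
  on the fresh ones, and then factored through the quotient. Well-formedness of \<open>Q\<close> and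
  \<open>G\<close> keeps its values among the vertices.\<close>

lemma realized_ainj_sat:
  assumes "realized G Q vs" and wf: "is_crpq A Q" and G: "is_graph_db A G"
  shows "ainj_sat Q G vs"
proof -
  obtain zs \<mu> where zs: "map fst zs = atoms Q" "realizes G zs \<mu>"
    and \<mu>: "\<mu> ` qvars Q \<subseteq> verts G" "vs = map \<mu> (qfree Q)"
    using assms(1) unfolding realized_def by blast
  define \<phi> where "\<phi> = map snd zs"
  have len: "length \<phi> = length (atoms Q)"
    unfolding \<phi>_def using arg_cong[OF zs(1), of length] by simp
  have zip: "zs = zip (atoms Q) \<phi>"
    by (simp add: \<phi>_def zs(1)[symmetric] zip_map_fst_snd)
  \<comment> \<open>The equivalence used in \<open>realizes\<close>, rewritten as equality in the
    quotient of the expansion.\<close>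
  define E where "E x y \<longleftrightarrow> quotient_map Q \<phi> (Var x) = quotient_map Q \<phi> (Var y)" for x y
  have atom: "realizes_atom G E \<mu> (atoms Q ! i, \<phi> ! i)" if "i < length (atoms Q)" for i
  proof -
    have "(atoms Q ! i, \<phi> ! i) \<in> set zs"
      unfolding zip using that len by (auto simp: set_zip)
    moreover have "equivclp (\<lambda>x y. (x, y) \<in> var_eqs zs) = E"
      unfolding E_def zip by (intro ext) (simp add: quotient_map_eq_Var_iff[OF len])
    ultimately show ?thesis
      using zs(2) unfolding realizes_def by auto
  qed
  have "\<exists>f. \<forall>x L y. i < length (atoms Q) \<and> atoms Q ! i = (x, L, y) \<and> \<phi> ! i \<noteq> [] \<longrightarrow>
      simple_walk G (\<mu> x) (\<phi> ! i) (\<mu> y) f" for i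
    using atom[of i] by (cases "atoms Q ! i") (auto split: if_splits)
  then obtain f where f: "\<And>i x L y. i < length (atoms Q) \<Longrightarrow> atoms Q ! i = (x, L, y) \<Longrightarrow>
      \<phi> ! i \<noteq> [] \<Longrightarrow> simple_walk G (\<mu> x) (\<phi> ! i) (\<mu> y) (f i)"
    by metis
  define g where "g v = (case v of Var x \<Rightarrow> \<mu> x | Fresh i j \<Rightarrow> f i j)" for v
  have g_node: "g (exp_node i x y (length (\<phi> ! i)) j) = f i j"
    if "i < length (atoms Q)" "atoms Q ! i = (x, L, y)" "\<phi> ! i \<noteq> []" for i x L y j
    using f[OF that] by (auto simp: simple_walk_def g_def exp_node_def)
  have "g a = g b" if eq: "(a, b) \<in> expansion_eqs Q \<phi>" for a b
  proof -
    obtain i x L y where i: "i < length (atoms Q)" "atoms Q ! i = (x, L, y)" "\<phi> ! i = []"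
      and ab: "a = Var x" "b = Var y"
      using eq unfolding expansion_eqs_iff by blast
    then show ?thesis
      using atom[OF i(1)] by (simp add: g_def)
  qed
  then obtain h where h: "h \<circ> quotient_map Q \<phi> = g"
    unfolding quotient_map_def by (rule factor_through_eq_class)
  have atom_vars: "x \<in> qvars Q" "y \<in> qvars Q"
    if "i < length (atoms Q)" "atoms Q ! i = (x, L, y)" for i x L y
    using wf nth_mem[OF that(1)] unfolding that(2) is_crpq_def by auto
  have verts: "g v \<in> verts G" if i: "i < length (atoms Q)" and v: "v \<in> atom_exp_vars Q \<phi> i" for i v
  proof -
    obtain x L y where a: "atoms Q ! i = (x, L, y)"
      by (metis prod_cases3)
    consider "v = Var x" | "v = Var y" | j where "v = Fresh i j" "j < length (\<phi> ! i)"
      using v by (auto simp: atom_exp_vars_def a word_exp_vars_def)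
    then show ?thesis
    proof cases
      case 3
      then have "\<phi> ! i \<noteq> []"
        by auto
      then show ?thesis
        using simple_walk_in_verts[OF f[OF i a] G, of j] 3 by (simp add: g_def)
    qed (use atom_vars[OF i a] \<mu>(1) in \<open>auto simp: g_def\<close>)
  qed
  have "is_hom g (pre_expansion Q \<phi>) G vs"
    unfolding is_hom_def
  proof (intro conjI)
    show "g ` verts (db (pre_expansion Q \<phi>)) \<subseteq> verts G"
      using verts \<mu>(1) by (auto simp: pre_expansion_def g_def)
    show "map g (free (pre_expansion Q \<phi>)) = vs"
      by (simp add: pre_expansion_def \<mu>(2) g_def)
    have "(g a, c, g b) \<in> edges G"
      if i: "i < length (atoms Q)" "atoms Q ! i = (x, L, y)"
        and e: "(a, c, b) \<in> word_exp_edges i x y (\<phi> ! i)" for i x L y a b c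
    proof -
      obtain j where j: "j < length (\<phi> ! i)" "a = exp_node i x y (length (\<phi> ! i)) j"
        "c = \<phi> ! i ! j" "b = exp_node i x y (length (\<phi> ! i)) (Suc j)"
        using e by (auto simp: word_exp_edges_def)
      then have "\<phi> ! i \<noteq> []"
        by auto
      then show ?thesis
        using f[OF i] j g_node[OF i] by (simp add: simple_walk_def)
    qed
    then show "\<forall>(a, c, b) \<in> edges (db (pre_expansion Q \<phi>)). (g a, c, g b) \<in> edges G"
      by (auto simp: pre_expansion_def split: prod.splits)
  qed
  then have "is_hom h (expansion Q \<phi>) G vs"
    unfolding expansion_def is_hom_collapse h[unfolded quotient_map_def] .
  moreover have "is_profile Q \<phi>"
    unfolding is_profile_def
  proof (rule list_all2_all_nthI)
    fix i
    assume "i < length (atoms Q)"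
    then show "(case atoms Q ! i of (x, L, y) \<Rightarrow> \<lambda>w. w \<in> L) (\<phi> ! i)"
      using atom[of i] by (cases "atoms Q ! i") auto
  qed (simp add: len)
  moreover have "h s \<noteq> h t" if rel: "atom_related Q \<phi> s t" and "s \<noteq> t" for s t
  proof
    assume "h s = h t"
    obtain i u v where i: "i < length (atoms Q)"
      and uv: "u \<in> atom_exp_vars Q \<phi> i" "v \<in> atom_exp_vars Q \<phi> i"
      and st: "s = quotient_map Q \<phi> u" "t = quotient_map Q \<phi> v"
      using rel unfolding atom_related_def by blast
    have "g u = g v"
      using \<open>h s = h t\<close> unfolding st h[symmetric] by simp
    obtain x L y where a: "atoms Q ! i = (x, L, y)"
      by (metis prod_cases3)
    show False
    proof (cases "\<phi> ! i = []")
      case True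
      then have "(Var x, Var y) \<in> expansion_eqs Q \<phi>"
        unfolding expansion_eqs_iff using i a by blast
      then have "quotient_map Q \<phi> (Var x) = quotient_map Q \<phi> (Var y)"
        unfolding quotient_map_def eq_class_eq_iff by (rule r_into_equivclp)
      then show False
        using uv st \<open>s \<noteq> t\<close> True by (auto simp: atom_exp_vars_def a word_exp_vars_def)
    next
      case False
      let ?n = "exp_node i x y (length (\<phi> ! i))"
      \<comment> \<open>A walk repeats a vertex only at its two ends. Then
        \<open>\<mu> x = \<mu> y\<close>, and the last clause of \<open>realizes_atom\<close> says
        that the quotient identifies them as well.\<close>
      have ends: "?n j = ?n k \<or> quotient_map Q \<phi> (?n j) = quotient_map Q \<phi> (?n k)"
        if "j < k" "k \<le> length (\<phi> ! i)" "f i j = f i k" for j k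
      proof -
        have "j = 0" "k = length (\<phi> ! i)"
          using f[OF i a False] that by (auto simp: simple_walk_def)
        moreover have "\<mu> x = \<mu> y"
          using f[OF i a False] that calculation by (simp add: simple_walk_def)
        ultimately show ?thesis
          using atom[OF i] False by (simp add: a E_def exp_node_0 exp_node_length)
      qed
      obtain j k where jk: "j \<le> length (\<phi> ! i)" "k \<le> length (\<phi> ! i)" "u = ?n j" "v = ?n k"
        using uv by (auto simp: atom_exp_vars_def a word_exp_vars_eq[OF False])
      then have "f i j = f i k"
        using \<open>g u = g v\<close> g_node[OF i a False] by simp
      then show False
        using ends[of j k] ends[of k j] jk st \<open>s \<noteq> t\<close> by (cases j k rule: linorder_cases) auto
    qed
  qed
  ultimately show ?thesis
    unfolding ainj_sat_def by blast
qed

lemma ainj_eval_iff_ainj_sat: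
  assumes "is_graph_db A G" and "is_crpq A Q"
  shows "vs \<in> ainj_eval Q G \<longleftrightarrow> ainj_sat Q G vs"
  unfolding ainj_eval_def mem_Collect_eq
  using assms ainj_answer_realized realized_ainj_answer realized_ainj_sat ainj_sat_realized by blast

section \<open>Expansions as graph databases\<close>

definition is_cq :: "'a set \<Rightarrow> ('v, 'a) cq \<Rightarrow> bool" where
  "is_cq A P \<longleftrightarrow> is_graph_db A (db P) \<and> set (free P) \<subseteq> verts (db P)"

lemma is_cq_collapse:
  assumes "is_cq A P"
  shows "is_cq A (collapse J P)"
  using assms unfolding is_cq_def is_graph_db_def collapse_def by auto

lemma set_lang_subset: "w \<in> lang r \<Longrightarrow> set w \<subseteq> set_rexp r"
proof (induction r arbitrary: w)
  case (Times r s)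
  then obtain u v where "w = u @ v" "u \<in> lang r" "v \<in> lang s"
    by auto
  then show ?case
    using Times.IH(1)[of u] Times.IH(2)[of v] by auto
next
  case (Star r)
  then obtain ws where "w = concat ws" "set ws \<subseteq> lang r"
    by auto
  then show ?case
    using Star.IH by auto
qed auto

text \<open>This makes expansions admissible as databases over \<open>A\<close>: letters of the
  chosen words lie in \<open>A\<close> because the languages are regular over
  \<open>A\<close>.\<close>

lemma is_cq_pre_expansion:
  assumes wf: "is_crpq A Q" and \<phi>: "is_profile Q \<phi>"
  shows "is_cq A (pre_expansion Q \<phi>)"
proof -
  have "finite (atom_exp_vars Q \<phi> i)" for i
    by (simp add: atom_exp_vars_def word_exp_vars_def split_beta)
  then have "finite (verts (db (pre_expansion Q \<phi>)))"
    using wf by (simp add: pre_expansion_def is_crpq_def)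
  moreover have "a \<in> verts (db (pre_expansion Q \<phi>)) \<and> c \<in> A \<and>
      b \<in> verts (db (pre_expansion Q \<phi>))"
    if e: "(a, c, b) \<in> edges (db (pre_expansion Q \<phi>))" for a c b
  proof -
    obtain i where i: "i < length (atoms Q)"
      "(a, c, b) \<in> (case atoms Q ! i of (x, L, y) \<Rightarrow> word_exp_edges i x y (\<phi> ! i))"
      using e by (auto simp: pre_expansion_def)
    obtain x L y where a: "atoms Q ! i = (x, L, y)"
      by (metis prod_cases3)
    define w where "w = \<phi> ! i"
    obtain j where j: "j < length w" "a = exp_node i x y (length w) j"
      "c = w ! j" "b = exp_node i x y (length w) (Suc j)"
      using i(2) by (auto simp: a w_def word_exp_edges_def)
    have "w \<in> L"
      using \<phi> i(1) a unfolding is_profile_def w_def by (auto dest!: list_all2_nthD)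
    moreover have "regular_over A L"
      using wf nth_mem[OF i(1)] unfolding a is_crpq_def by auto
    ultimately have "set w \<subseteq> A"
      unfolding regular_over_def using set_lang_subset by blast
    moreover have "w \<noteq> []"
      using j(1) by auto
    then have "{a, b} \<subseteq> atom_exp_vars Q \<phi> i"
      unfolding atom_exp_vars_def a using j by (simp add: word_exp_vars_eq flip: w_def)
    then have "{a, b} \<subseteq> verts (db (pre_expansion Q \<phi>))"
      using i(1) by (auto simp: pre_expansion_def)
    ultimately show ?thesis
      using j(1,3) by (auto intro: nth_mem)
  qed
  moreover have "set (free (pre_expansion Q \<phi>)) \<subseteq> verts (db (pre_expansion Q \<phi>))"
    using wf by (auto simp: pre_expansion_def is_crpq_def)
  ultimately show ?thesis
    unfolding is_cq_def is_graph_db_def by auto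
qed

lemma is_cq_Exp_ainj:
  assumes "is_crpq A Q" and "F \<in> Exp_ainj Q"
  shows "is_cq A F"
proof -
  obtain \<phi> J where "is_profile Q \<phi>" "F = collapse J (expansion Q \<phi>)"
    using assms(2) unfolding Exp_ainj_def produces_def by blast
  then show ?thesis
    using assms(1) by (simp add: expansion_def is_cq_collapse is_cq_pre_expansion)
qed

text \<open>Vertices of atom-injective expansions are sets of sets of type \<open>evar\<close>,
  while containment speaks of databases over another, infinite type. Their finite vertex sets can be
  embedded there.\<close>

lemma ex_inj_on_infinite_type:
  assumes "finite V"
  obtains \<iota> :: "'u \<Rightarrow> 'v::infinite" where "inj_on \<iota> V"
proof -
  obtain B :: "'v set" where "finite B" "card B = card V"
    using infinite_arbitrarily_large[OF infinite_UNIV] by blast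
  then show thesis
    using assms that by (metis bij_betw_def finite_same_card_bij)
qed

text \<open>Satisfaction is to be carried to the copy and back, hence injective homomorphisms both
  ways: \<open>\<iota>\<close>, and its inverse \<open>\<kappa>\<close> on the vertices.\<close>

lemma copy_cq:
  fixes P :: "('u, 'a) cq"
  assumes P: "is_cq A P" and \<iota>: "inj_on \<iota> (verts (db P))"
  obtains P' :: "('v, 'a) cq" and \<kappa> where "is_cq A P'"
    and "is_hom \<iota> P (db P') (free P')"
    and "is_hom \<kappa> P' (db P) (free P)" and "inj_on \<kappa> (verts (db P'))"
proof -
  define V where "V = verts (db P)"
  define P' where "P' = \<lparr>db = \<lparr>verts = \<iota> ` V,
      edges = (\<lambda>(x, a, y). (\<iota> x, a, \<iota> y)) ` edges (db P)\<rparr>, free = map \<iota> (free P)\<rparr>"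
  define \<kappa> where "\<kappa> = inv_into V \<iota>"
  have edge: "x \<in> V \<and> a \<in> A \<and> y \<in> V" if "(x, a, y) \<in> edges (db P)" for x a y
    using P that by (auto simp: is_cq_def is_graph_db_def V_def)
  have free: "set (free P) \<subseteq> V" and "finite V"
    using P by (auto simp: is_cq_def is_graph_db_def V_def)
  have \<kappa>: "\<kappa> (\<iota> x) = x" if "x \<in> V" for x
    using \<iota> that by (simp add: \<kappa>_def V_def)
  have "is_cq A P'"
    using edge free \<open>finite V\<close> by (auto simp: P'_def is_cq_def is_graph_db_def)
  moreover have "is_hom \<iota> P (db P') (free P')"
    unfolding is_hom_def P'_def V_def by (auto intro: rev_image_eqI)
  moreover have "is_hom \<kappa> P' (db P) (free P)"
  proof -
    have "map (\<lambda>x. \<kappa> (\<iota> x)) (free P) = free P"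
      using free \<kappa> by (intro map_idI) auto
    then show ?thesis
      unfolding is_hom_def using edge \<kappa> by (auto simp: P'_def comp_def V_def)
  qed
  moreover have "inj_on \<kappa> (verts (db P'))"
    by (simp add: P'_def \<kappa>_def inj_on_inv_into)
  ultimately show thesis
    by (rule that)
qed

section \<open>Equivalence of the three conditions\<close>

theorem proposition4p6:
  fixes A :: "'a set" and Q1 Q2 :: "('x, 'a) crpq"
  assumes "finite A" and "is_crpq A Q1" and "is_crpq A Q2"
  shows "((\<forall>G :: ('v::infinite, 'a) graph_db. is_graph_db A G \<longrightarrow> ainj_eval Q1 G \<subseteq> ainj_eval Q2 G)
            \<longleftrightarrow> (\<forall>F1 \<in> Exp_ainj Q1. \<exists>E2 \<in> Exp Q2. ainj_hom Q2 E2 F1))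
       \<and> ((\<forall>F1 \<in> Exp_ainj Q1. \<exists>E2 \<in> Exp Q2. ainj_hom Q2 E2 F1)
            \<longleftrightarrow> (\<forall>F1 \<in> Exp_ainj Q1. \<exists>F2 \<in> Exp_ainj Q2. inj_hom F2 F1))"
proof
  show "(\<forall>F1 \<in> Exp_ainj Q1. \<exists>E2 \<in> Exp Q2. ainj_hom Q2 E2 F1)
      \<longleftrightarrow> (\<forall>F1 \<in> Exp_ainj Q1. \<exists>F2 \<in> Exp_ainj Q2. inj_hom F2 F1)"
    \<comment> \<open>Both conditions unfold to an injective homomorphism into \<open>F1\<close>
      from some atom-injective expansion of \<open>Q2\<close>.\<close>
    unfolding ainj_hom_iff_ainj_sat ainj_sat_iff_inj_hom inj_hom_def by blast
next
  show "(\<forall>G :: ('v::infinite, 'a) graph_db. is_graph_db A G \<longrightarrow> ainj_eval Q1 G \<subseteq> ainj_eval Q2 G)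
      \<longleftrightarrow> (\<forall>F1 \<in> Exp_ainj Q1. \<exists>E2 \<in> Exp Q2. ainj_hom Q2 E2 F1)"
    unfolding ainj_hom_iff_ainj_sat
  proof (intro iffI ballI allI impI subsetI)
    fix F1
    assume contained:
      "\<forall>G :: ('v, 'a) graph_db. is_graph_db A G \<longrightarrow> ainj_eval Q1 G \<subseteq> ainj_eval Q2 G"
      and F1: "F1 \<in> Exp_ainj Q1"
    have cq: "is_cq A F1"
      using is_cq_Exp_ainj assms(2) F1 by blast
    then have "finite (verts (db F1))"
      by (simp add: is_cq_def is_graph_db_def)
    then obtain \<iota> :: "_ \<Rightarrow> 'v" where \<iota>: "inj_on \<iota> (verts (db F1))"
      by (rule ex_inj_on_infinite_type)
    from copy_cq[OF cq \<iota>] obtain P :: "('v, 'a) cq" and \<kappa> where P: "is_cq A P"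
      and copy: "is_hom \<iota> F1 (db P) (free P)"
      and proj: "is_hom \<kappa> P (db F1) (free F1)" "inj_on \<kappa> (verts (db P))" .
    have G: "is_graph_db A (db P)"
      using P by (simp add: is_cq_def)
    \<comment> \<open>\<open>F1\<close> yields an answer to \<open>Q1\<close> on its copy;
      containment makes it an answer to \<open>Q2\<close>, and \<open>\<kappa>\<close> carries this
      back to \<open>F1\<close>.\<close>
    have "ainj_sat Q1 (db P) (free P)"
      using ainj_sat_inj_hom[OF Exp_ainj_sat[OF F1] copy \<iota>] .
    then have "ainj_sat Q2 (db P) (free P)"
      using contained G ainj_eval_iff_ainj_sat[OF G] assms(2,3) by blast
    then show "ainj_sat Q2 (db F1) (free F1)"
      using proj by (rule ainj_sat_inj_hom)
  next
    fix G :: "('v, 'a) graph_db" and vs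
    assume contained: "\<forall>F1 \<in> Exp_ainj Q1. ainj_sat Q2 (db F1) (free F1)"
      and G: "is_graph_db A G" and "vs \<in> ainj_eval Q1 G"
    then have "ainj_sat Q1 G vs"
      using ainj_eval_iff_ainj_sat assms(2) by blast
    \<comment> \<open>The answer to \<open>Q1\<close> comes from an injective image of some
      \<open>F1\<close>; the satisfaction of \<open>Q2\<close> on \<open>F1\<close> is transported
      along the same map.\<close>
    then obtain F1 g where "F1 \<in> Exp_ainj Q1" "is_hom g F1 G vs" "inj_on g (verts (db F1))"
      unfolding ainj_sat_iff_inj_hom by blast
    then have "ainj_sat Q2 G vs"
      using contained ainj_sat_inj_hom by blast
    then show "vs \<in> ainj_eval Q2 G"
      using ainj_eval_iff_ainj_sat[OF G assms(3)] by blast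
  qed
qed

end
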